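(* Let $(L_i \mid i\in I)$ be a family of join-semilattices, and $\varphi_i\colon L_i\to M$ a family of isotone maps from the $L_i$ to a common join-semilattice $M$. Let $L$ denote the free product of the $L_i$ as join-semilattices. Then there exists an isotone map $\varphi\colon L\to M$ whose restrictions to the $L_i\subseteq L$ are the $\varphi_i$.
   Context: An isotone map is an order-preserving map (not assumed to preserve joins). The free product of a family of join-semilattices is their coproduct in the category of join-semilattices and join-preserving maps (binary joins; no least element required or preserved); the canonical maps $L_i\to L$ are embeddings, and each $L_i$ is identified with its image. *)

theory Defs
  imports "HOL-Algebra.Lattice" "HOL-Library.FuncSet"
begin

text \<open>
  A join-semilattice is an \<open>upper_semilattice\<close>: a partial order on a carrier set in which any two
  elements have a least upper bound.  No least element is required, and the carrier may be empty.
  \<open>join_pres\<close> from the library is not usable for homomorphisms, as it demands full lattices.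
\<close>

definition semilattice_hom :: "('a, 'c) gorder_scheme \<Rightarrow> ('b, 'd) gorder_scheme \<Rightarrow> ('a \<Rightarrow> 'b) set"
  where "semilattice_hom S T =
    {h \<in> carrier S \<rightarrow> carrier T.
      \<forall>x\<in>carrier S. \<forall>y\<in>carrier S. h (x \<squnion>\<^bsub>S\<^esub> y) = h x \<squnion>\<^bsub>T\<^esub> h y}"

text \<open>
  The universal property of the coproduct of \<open>(A i | i \<in> I)\<close>, with object \<open>L\<close> and canonical
  maps \<open>\<iota> i\<close>, tested against all join-semilattices \<open>T\<close> whose carrier is a subset of the type \<open>'t\<close>.
  The carriers of the \<open>A i\<close> lie in one type \<open>'a\<close> but are unrelated; in particular they may overlap.
  Extensionality only makes the uniqueness of \<open>h\<close> refer to its values on the carrier of \<open>L\<close>.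
\<close>

definition semilattice_coproduct ::
    "'t itself \<Rightarrow> 'i set \<Rightarrow> ('i \<Rightarrow> 'a gorder) \<Rightarrow> 'l gorder \<Rightarrow> ('i \<Rightarrow> 'a \<Rightarrow> 'l) \<Rightarrow> bool"
  where "semilattice_coproduct _ I A L \<iota> \<longleftrightarrow>
    upper_semilattice L \<and>
    (\<forall>i\<in>I. \<iota> i \<in> semilattice_hom (A i) L) \<and>
    (\<forall>(T :: 't gorder) g.
      upper_semilattice T \<and> (\<forall>i\<in>I. g i \<in> semilattice_hom (A i) T) \<longrightarrow>
      (\<exists>!h. h \<in> semilattice_hom L T \<and> h \<in> extensional (carrier L) \<and>
            (\<forall>i\<in>I. \<forall>x\<in>carrier (A i). h (\<iota> i x) = g i x)))"

text \<open>
  A formula cannot quantify over types, so the test objects have to live in one fixed type.  The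
  type \<open>'i \<Rightarrow> 'a option\<close> is large enough: by \<open>free_product_universal\<close> below, the universal property
  for it entails the universal property for every other type.
\<close>

definition free_product ::
    "'i set \<Rightarrow> ('i \<Rightarrow> 'a gorder) \<Rightarrow> 'l gorder \<Rightarrow> ('i \<Rightarrow> 'a \<Rightarrow> 'l) \<Rightarrow> bool"
  where "free_product I A L \<iota> \<longleftrightarrow> semilattice_coproduct TYPE('i \<Rightarrow> 'a option) I A L \<iota>"


subsection \<open>Join-semilattices\<close>

lemma usl_refl: "upper_semilattice S \<Longrightarrow> x \<in> carrier S \<Longrightarrow> x \<sqsubseteq>\<^bsub>S\<^esub> x"
proof -
  assume "upper_semilattice S" "x \<in> carrier S"
  then interpret upper_semilattice S by simp
  show ?thesis using \<open>x \<in> carrier S\<close> by simp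
qed

lemma usl_antisym:
  assumes "upper_semilattice S" "x \<sqsubseteq>\<^bsub>S\<^esub> y" "y \<sqsubseteq>\<^bsub>S\<^esub> x" "x \<in> carrier S" "y \<in> carrier S"
  shows "x = y"
proof -
  interpret upper_semilattice S by fact
  show ?thesis using assms by (intro le_antisym)
qed

lemma usl_trans:
  assumes "upper_semilattice S" "x \<sqsubseteq>\<^bsub>S\<^esub> y" "y \<sqsubseteq>\<^bsub>S\<^esub> z"
    "x \<in> carrier S" "y \<in> carrier S" "z \<in> carrier S"
  shows "x \<sqsubseteq>\<^bsub>S\<^esub> z"
proof -
  interpret upper_semilattice S by fact
  show ?thesis using assms by (intro le_trans[of x y z])
qed

lemma usl_join_closed:
  assumes "upper_semilattice S" "x \<in> carrier S" "y \<in> carrier S"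
  shows "x \<squnion>\<^bsub>S\<^esub> y \<in> carrier S"
proof -
  interpret upper_semilattice S by fact
  show ?thesis using assms by simp
qed

lemma usl_join_le_iff:
  assumes "upper_semilattice S" "x \<in> carrier S" "y \<in> carrier S" "z \<in> carrier S"
  shows "x \<squnion>\<^bsub>S\<^esub> y \<sqsubseteq>\<^bsub>S\<^esub> z \<longleftrightarrow> x \<sqsubseteq>\<^bsub>S\<^esub> z \<and> y \<sqsubseteq>\<^bsub>S\<^esub> z"
proof -
  interpret upper_semilattice S by fact
  note c = join_closed[OF assms(2,3)]
  note l = join_left[OF assms(2,3)] and r = join_right[OF assms(2,3)]
  show ?thesis
    using join_le[OF _ _ assms(2-4)] le_trans[OF l _ assms(2) c assms(4)]
      le_trans[OF r _ assms(3) c assms(4)] by blast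
qed

lemma usl_join_eqI:
  assumes S: "upper_semilattice S"
    and xyu: "x \<in> carrier S" "y \<in> carrier S" "u \<in> carrier S"
    and u: "\<And>z. z \<in> carrier S \<Longrightarrow> u \<sqsubseteq>\<^bsub>S\<^esub> z \<longleftrightarrow> x \<sqsubseteq>\<^bsub>S\<^esub> z \<and> y \<sqsubseteq>\<^bsub>S\<^esub> z"
  shows "x \<squnion>\<^bsub>S\<^esub> y = u"
proof (rule usl_antisym[OF S])
  note c = usl_join_closed[OF S xyu(1,2)]
  show "x \<squnion>\<^bsub>S\<^esub> y \<in> carrier S" "u \<in> carrier S"
    using c xyu by auto
  show "x \<squnion>\<^bsub>S\<^esub> y \<sqsubseteq>\<^bsub>S\<^esub> u"
    using usl_join_le_iff[OF S xyu] u[of u] usl_refl[OF S xyu(3)] xyu by blast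
  show "u \<sqsubseteq>\<^bsub>S\<^esub> x \<squnion>\<^bsub>S\<^esub> y"
    using usl_join_le_iff[OF S xyu(1,2) c] u[OF c] usl_refl[OF S c] by blast
qed

lemma usl_join_eq_iff:
  assumes S: "upper_semilattice S" and xy: "x \<in> carrier S" "y \<in> carrier S"
  shows "x \<squnion>\<^bsub>S\<^esub> y = y \<longleftrightarrow> x \<sqsubseteq>\<^bsub>S\<^esub> y"
proof
  assume "x \<squnion>\<^bsub>S\<^esub> y = y"
  then show "x \<sqsubseteq>\<^bsub>S\<^esub> y" using usl_join_le_iff[OF S xy xy(2)] usl_refl[OF S xy(2)] by simp
next
  assume le: "x \<sqsubseteq>\<^bsub>S\<^esub> y"
  show "x \<squnion>\<^bsub>S\<^esub> y = y"
    by (rule usl_join_eqI[OF S xy xy(2)]) (use usl_trans[OF S le] xy in blast)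
qed

lemma uslI:
  assumes eq: "eq S = (=)"
    and refl: "\<And>x. x \<in> carrier S \<Longrightarrow> x \<sqsubseteq>\<^bsub>S\<^esub> x"
    and antisym: "\<And>x y. \<lbrakk>x \<in> carrier S; y \<in> carrier S; x \<sqsubseteq>\<^bsub>S\<^esub> y; y \<sqsubseteq>\<^bsub>S\<^esub> x\<rbrakk> \<Longrightarrow> x = y"
    and trans: "\<And>x y z. \<lbrakk>x \<in> carrier S; y \<in> carrier S; z \<in> carrier S; x \<sqsubseteq>\<^bsub>S\<^esub> y; y \<sqsubseteq>\<^bsub>S\<^esub> z\<rbrakk>
      \<Longrightarrow> x \<sqsubseteq>\<^bsub>S\<^esub> z"
    and sup: "\<And>x y. \<lbrakk>x \<in> carrier S; y \<in> carrier S\<rbrakk> \<Longrightarrow>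
      \<exists>u\<in>carrier S. \<forall>z\<in>carrier S. u \<sqsubseteq>\<^bsub>S\<^esub> z \<longleftrightarrow> x \<sqsubseteq>\<^bsub>S\<^esub> z \<and> y \<sqsubseteq>\<^bsub>S\<^esub> z"
  shows "upper_semilattice S"
proof
  fix x y assume xy: "x \<in> carrier S" "y \<in> carrier S"
  then obtain u where u: "u \<in> carrier S"
    "\<forall>z\<in>carrier S. u \<sqsubseteq>\<^bsub>S\<^esub> z \<longleftrightarrow> x \<sqsubseteq>\<^bsub>S\<^esub> z \<and> y \<sqsubseteq>\<^bsub>S\<^esub> z"
    using sup by blast
  have "least S u (Upper S {x, y})"
    by (rule least_UpperI) (use u xy refl in \<open>auto simp: Upper_def\<close>)
  then show "\<exists>s. least S s (Upper S {x, y})" by blast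
next
  fix x y z assume "x \<sqsubseteq>\<^bsub>S\<^esub> y" "y \<sqsubseteq>\<^bsub>S\<^esub> z" "x \<in> carrier S" "y \<in> carrier S" "z \<in> carrier S"
  then show "x \<sqsubseteq>\<^bsub>S\<^esub> z" using trans by blast
next
  fix x y assume "x \<sqsubseteq>\<^bsub>S\<^esub> y" "y \<sqsubseteq>\<^bsub>S\<^esub> x" "x \<in> carrier S" "y \<in> carrier S"
  then show "x .=\<^bsub>S\<^esub> y" using antisym eq by simp
qed (simp_all add: eq refl)

lemma hom_closed: "h \<in> semilattice_hom S T \<Longrightarrow> x \<in> carrier S \<Longrightarrow> h x \<in> carrier T"
  by (auto simp: semilattice_hom_def)

lemma hom_join:
  "h \<in> semilattice_hom S T \<Longrightarrow> x \<in> carrier S \<Longrightarrow> y \<in> carrier S \<Longrightarrow> h (x \<squnion>\<^bsub>S\<^esub> y) = h x \<squnion>\<^bsub>T\<^esub> h y"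
  by (auto simp: semilattice_hom_def)

lemma hom_mono:
  assumes "upper_semilattice S" "upper_semilattice T" "h \<in> semilattice_hom S T"
    "x \<in> carrier S" "y \<in> carrier S" "x \<sqsubseteq>\<^bsub>S\<^esub> y"
  shows "h x \<sqsubseteq>\<^bsub>T\<^esub> h y"
proof -
  have "x \<squnion>\<^bsub>S\<^esub> y = y" using usl_join_eq_iff[OF assms(1,4,5)] assms(6) by blast
  then have "h x \<squnion>\<^bsub>T\<^esub> h y = h y" using hom_join[OF assms(3-5)] by simp
  then show ?thesis
    using usl_join_eq_iff[OF assms(2) hom_closed[OF assms(3,4)] hom_closed[OF assms(3,5)]] by blast
qed

lemma hom_comp:
  "h \<in> semilattice_hom S T \<Longrightarrow> k \<in> semilattice_hom T U \<Longrightarrow> (\<lambda>x. k (h x)) \<in> semilattice_hom S U"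
  by (auto simp: semilattice_hom_def Pi_iff)

lemma hom_restrict:
  assumes "upper_semilattice S" "h \<in> semilattice_hom S T"
  shows "restrict h (carrier S) \<in> semilattice_hom S T"
  using assms by (auto simp: semilattice_hom_def usl_join_closed)

lemma coproduct_ex1:
  fixes T :: "'t gorder"
  assumes cop: "semilattice_coproduct TYPE('t) I A L \<iota>" and T: "upper_semilattice T"
    and g: "\<And>i. i \<in> I \<Longrightarrow> g i \<in> semilattice_hom (A i) T"
  shows "\<exists>!h. h \<in> semilattice_hom L T \<and> h \<in> extensional (carrier L) \<and>
            (\<forall>i\<in>I. \<forall>x\<in>carrier (A i). h (\<iota> i x) = g i x)"
proof -
  have "\<forall>(T :: 't gorder) g.
      upper_semilattice T \<and> (\<forall>i\<in>I. g i \<in> semilattice_hom (A i) T) \<longrightarrow>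
      (\<exists>!h. h \<in> semilattice_hom L T \<and> h \<in> extensional (carrier L) \<and>
            (\<forall>i\<in>I. \<forall>x\<in>carrier (A i). h (\<iota> i x) = g i x))"
    using cop unfolding semilattice_coproduct_def by (elim conjE)
  from this[rule_format, of T g] show ?thesis using T g by auto
qed

lemma coproduct_ex:
  fixes T :: "'t gorder"
  assumes "semilattice_coproduct TYPE('t) I A L \<iota>" "upper_semilattice T"
    "\<And>i. i \<in> I \<Longrightarrow> g i \<in> semilattice_hom (A i) T"
  obtains h where "h \<in> semilattice_hom L T" "\<And>i x. i \<in> I \<Longrightarrow> x \<in> carrier (A i) \<Longrightarrow> h (\<iota> i x) = g i x"
proof -
  have "\<exists>!h. h \<in> semilattice_hom L T \<and> h \<in> extensional (carrier L) \<and>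
            (\<forall>i\<in>I. \<forall>x\<in>carrier (A i). h (\<iota> i x) = g i x)"
    by (rule coproduct_ex1) (use assms in auto)
  then show ?thesis by (elim ex1E conjE) (auto intro: that)
qed

lemma coproduct_unique:
  fixes T :: "'t gorder"
  assumes cop: "semilattice_coproduct TYPE('t) I A L \<iota>" and T: "upper_semilattice T"
    and h: "h \<in> semilattice_hom L T" and k: "k \<in> semilattice_hom L T"
    and eq: "\<And>i x. i \<in> I \<Longrightarrow> x \<in> carrier (A i) \<Longrightarrow> h (\<iota> i x) = k (\<iota> i x)"
    and z: "z \<in> carrier L"
  shows "h z = k z"
proof -
  have L: "upper_semilattice L" and \<iota>: "\<And>i. i \<in> I \<Longrightarrow> \<iota> i \<in> semilattice_hom (A i) L"
    using cop unfolding semilattice_coproduct_def by blast+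
  have *: "\<exists>!f. f \<in> semilattice_hom L T \<and> f \<in> extensional (carrier L) \<and>
            (\<forall>i\<in>I. \<forall>x\<in>carrier (A i). f (\<iota> i x) = h (\<iota> i x))"
    by (rule coproduct_ex1[OF cop T]) (rule hom_comp[OF \<iota> h])
  have "restrict h (carrier L) \<in> semilattice_hom L T \<and>
      restrict h (carrier L) \<in> extensional (carrier L) \<and>
      (\<forall>i\<in>I. \<forall>x\<in>carrier (A i). restrict h (carrier L) (\<iota> i x) = h (\<iota> i x))"
    using hom_restrict[OF L h] hom_closed[OF \<iota>] by auto
  moreover have "restrict k (carrier L) \<in> semilattice_hom L T \<and>
      restrict k (carrier L) \<in> extensional (carrier L) \<and>
      (\<forall>i\<in>I. \<forall>x\<in>carrier (A i). restrict k (carrier L) (\<iota> i x) = h (\<iota> i x))"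
    using hom_restrict[OF L k] hom_closed[OF \<iota>] eq by auto
  ultimately have "restrict h (carrier L) = restrict k (carrier L)"
    using * by blast
  from fun_cong[OF this, of z] show ?thesis using z by simp
qed


subsection \<open>Existence, and independence of the test type\<close>

text \<open>
  A finite join of elements \<open>a i \<in> A i\<close>, one for each \<open>i\<close> in a finite nonempty subset of \<open>I\<close>, is
  represented by the partial function \<open>a\<close>.
\<close>

definition std_free_product :: "'i set \<Rightarrow> ('i \<Rightarrow> 'a gorder) \<Rightarrow> ('i \<Rightarrow> 'a option) gorder"
  where "std_free_product I A =
    \<lparr> carrier = {f. finite (dom f) \<and> dom f \<noteq> {} \<and> (\<forall>i a. f i = Some a \<longrightarrow> i \<in> I \<and> a \<in> carrier (A i))},
      eq = (=),
      le = (\<lambda>f g. \<forall>i a. f i = Some a \<longrightarrow> (\<exists>b. g i = Some b \<and> a \<sqsubseteq>\<^bsub>A i\<^esub> b)) \<rparr>"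

definition std_inj :: "'i \<Rightarrow> 'a \<Rightarrow> ('i \<Rightarrow> 'a option)"
  where "std_inj i a = [i \<mapsto> a]"

definition std_join :: "('i \<Rightarrow> 'a gorder) \<Rightarrow> ('i \<Rightarrow> 'a option) \<Rightarrow> ('i \<Rightarrow> 'a option) \<Rightarrow> ('i \<Rightarrow> 'a option)"
  where "std_join A f g = (\<lambda>i. case f i of None \<Rightarrow> g i
    | Some a \<Rightarrow> (case g i of None \<Rightarrow> Some a | Some b \<Rightarrow> Some (a \<squnion>\<^bsub>A i\<^esub> b)))"

locale semilattice_family =
  fixes I :: "'i set" and A :: "'i \<Rightarrow> 'a gorder"
  assumes usl: "i \<in> I \<Longrightarrow> upper_semilattice (A i)"
begin

abbreviation F where "F \<equiv> std_free_product I A"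

lemma carrier_F:
  "f \<in> carrier F \<longleftrightarrow>
    finite (dom f) \<and> dom f \<noteq> {} \<and> (\<forall>i a. f i = Some a \<longrightarrow> i \<in> I \<and> a \<in> carrier (A i))"
  by (simp add: std_free_product_def)

lemma le_F: "f \<sqsubseteq>\<^bsub>F\<^esub> g \<longleftrightarrow> (\<forall>i a. f i = Some a \<longrightarrow> (\<exists>b. g i = Some b \<and> a \<sqsubseteq>\<^bsub>A i\<^esub> b))"
  by (simp add: std_free_product_def)

lemma dom_std_join: "dom (std_join A f g) = dom f \<union> dom g"
  by (auto simp: std_join_def dom_def split: option.splits)

lemma std_join_closed:
  assumes "f \<in> carrier F" "g \<in> carrier F"
  shows "std_join A f g \<in> carrier F"
  unfolding carrier_F dom_std_join
  using assms usl by (auto simp: carrier_F std_join_def usl_join_closed split: option.splits)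

lemma std_join_le_iff:
  assumes f: "f \<in> carrier F" and g: "g \<in> carrier F" and h: "h \<in> carrier F"
  shows "std_join A f g \<sqsubseteq>\<^bsub>F\<^esub> h \<longleftrightarrow> f \<sqsubseteq>\<^bsub>F\<^esub> h \<and> g \<sqsubseteq>\<^bsub>F\<^esub> h"
proof -
  have "(\<forall>a. std_join A f g i = Some a \<longrightarrow> (\<exists>b. h i = Some b \<and> a \<sqsubseteq>\<^bsub>A i\<^esub> b)) \<longleftrightarrow>
      (\<forall>a. f i = Some a \<longrightarrow> (\<exists>b. h i = Some b \<and> a \<sqsubseteq>\<^bsub>A i\<^esub> b)) \<and>
      (\<forall>a. g i = Some a \<longrightarrow> (\<exists>b. h i = Some b \<and> a \<sqsubseteq>\<^bsub>A i\<^esub> b))" for i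
  proof (cases "i \<in> I")
    case True
    have "\<forall>a. f i = Some a \<longrightarrow> a \<in> carrier (A i)" "\<forall>a. g i = Some a \<longrightarrow> a \<in> carrier (A i)"
      "\<forall>a. h i = Some a \<longrightarrow> a \<in> carrier (A i)"
      using f g h by (auto simp: carrier_F)
    then show ?thesis
      using usl_join_le_iff[OF usl[OF True]]
      by (cases "f i"; cases "g i"; cases "h i") (auto simp: std_join_def)
  next
    case False
    then have "f i = None" "g i = None"
      using f g unfolding carrier_F by (metis not_Some_eq)+
    then show ?thesis by (simp add: std_join_def)
  qed
  then show ?thesis unfolding le_F by blast
qed

lemma usl_F: "upper_semilattice F"
proof (rule uslI)
  show "eq F = (=)" by (simp add: std_free_product_def)
next
  fix f assume "f \<in> carrier F"
  then show "f \<sqsubseteq>\<^bsub>F\<^esub> f" unfolding le_F carrier_F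
    by (auto intro: usl_refl[OF usl])
next
  fix f g assume fg: "f \<in> carrier F" "g \<in> carrier F" "f \<sqsubseteq>\<^bsub>F\<^esub> g" "g \<sqsubseteq>\<^bsub>F\<^esub> f"
  show "f = g"
  proof
    fix i show "f i = g i"
    proof (cases "f i")
      case None
      then show ?thesis using fg(4)[unfolded le_F, rule_format, of i] by (cases "g i") auto
    next
      case (Some a)
      then obtain b where b: "g i = Some b" "a \<sqsubseteq>\<^bsub>A i\<^esub> b" using fg(3)[unfolded le_F, rule_format, of i] by auto
      then have "b \<sqsubseteq>\<^bsub>A i\<^esub> a" using fg(4)[unfolded le_F, rule_format, of i b] Some by auto
      moreover have "i \<in> I" "a \<in> carrier (A i)" "b \<in> carrier (A i)"
        using fg(1,2) Some b unfolding carrier_F by blast+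
      ultimately have "a = b" using b(2) by (intro usl_antisym[OF usl])
      then show ?thesis using b Some by simp
    qed
  qed
next
  fix f g h
  assume fgh: "f \<in> carrier F" "g \<in> carrier F" "h \<in> carrier F" "f \<sqsubseteq>\<^bsub>F\<^esub> g" "g \<sqsubseteq>\<^bsub>F\<^esub> h"
  show "f \<sqsubseteq>\<^bsub>F\<^esub> h"
    unfolding le_F
  proof (intro allI impI)
    fix i a assume a: "f i = Some a"
    then obtain b where b: "g i = Some b" "a \<sqsubseteq>\<^bsub>A i\<^esub> b" using fgh(4)[unfolded le_F, rule_format, of i] by auto
    then obtain c where c: "h i = Some c" "b \<sqsubseteq>\<^bsub>A i\<^esub> c" using fgh(5)[unfolded le_F, rule_format, of i] by auto
    have i: "i \<in> I" and abc: "a \<in> carrier (A i)" "b \<in> carrier (A i)" "c \<in> carrier (A i)"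
      using fgh(1-3) a b(1) c(1) unfolding carrier_F by blast+
    show "\<exists>c. h i = Some c \<and> a \<sqsubseteq>\<^bsub>A i\<^esub> c"
      using usl_trans[OF usl[OF i] b(2) c(2) abc] c(1) by simp
  qed
next
  fix f g assume fg: "f \<in> carrier F" "g \<in> carrier F"
  show "\<exists>u\<in>carrier F. \<forall>z\<in>carrier F. u \<sqsubseteq>\<^bsub>F\<^esub> z \<longleftrightarrow> f \<sqsubseteq>\<^bsub>F\<^esub> z \<and> g \<sqsubseteq>\<^bsub>F\<^esub> z"
    by (rule bexI[OF _ std_join_closed[OF fg]]) (simp add: std_join_le_iff[OF fg])
qed

lemma join_F:
  assumes "f \<in> carrier F" "g \<in> carrier F"
  shows "f \<squnion>\<^bsub>F\<^esub> g = std_join A f g"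
  by (rule usl_join_eqI[OF usl_F]) (use assms std_join_closed std_join_le_iff in \<open>auto\<close>)

lemma std_inj_hom:
  assumes "i \<in> I"
  shows "std_inj i \<in> semilattice_hom (A i) F"
proof -
  have closed: "std_inj i a \<in> carrier F" if "a \<in> carrier (A i)" for a
    using that assms unfolding carrier_F std_inj_def by auto
  moreover have "std_inj i (a \<squnion>\<^bsub>A i\<^esub> b) = std_join A (std_inj i a) (std_inj i b)" for a b
    by (auto simp: std_inj_def std_join_def)
  ultimately show ?thesis by (auto simp: semilattice_hom_def join_F)
qed

lemma F_induct:
  assumes f: "f \<in> carrier F"
    and inj: "\<And>i a. i \<in> I \<Longrightarrow> a \<in> carrier (A i) \<Longrightarrow> P (std_inj i a)"
    and join: "\<And>f g. f \<in> carrier F \<Longrightarrow> g \<in> carrier F \<Longrightarrow> P f \<Longrightarrow> P g \<Longrightarrow> P (f \<squnion>\<^bsub>F\<^esub> g)"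
  shows "P f"
proof -
  have "finite D \<Longrightarrow> D \<noteq> {} \<Longrightarrow> \<forall>f\<in>carrier F. dom f = D \<longrightarrow> P f" for D
  proof (induction D rule: finite_ne_induct)
    case (singleton i)
    show ?case
    proof (intro ballI impI)
      fix f assume f: "f \<in> carrier F" "dom f = {i}"
      then obtain a where a: "f i = Some a" by (metis domD insertI1)
      have "f = std_inj i a"
      proof
        fix j show "f j = std_inj i a j"
          using a f(2) by (cases "j = i") (auto simp: std_inj_def domIff)
      qed
      moreover have "i \<in> I" "a \<in> carrier (A i)" using f(1) a unfolding carrier_F by blast+
      ultimately show "P f" using inj by simp
    qed
  next
    case (insert i D)
    show ?case
    proof (intro ballI impI)
      fix f assume f: "f \<in> carrier F" "dom f = insert i D"
      then obtain a where a: "f i = Some a" by (metis domD insertI1)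
      have ia: "i \<in> I" "a \<in> carrier (A i)" using f(1) a unfolding carrier_F by blast+
      define g where "g = f(i := None)"
      have dg: "dom g = D" using f(2) insert.hyps by (auto simp: g_def)
      then have g: "g \<in> carrier F"
        using f(1) insert.hyps unfolding carrier_F dg by (auto simp: g_def)
      have s: "std_inj i a \<in> carrier F" using hom_closed[OF std_inj_hom] ia by blast
      have "f = std_join A (std_inj i a) g"
      proof
        fix j show "f j = std_join A (std_inj i a) g j"
          using a by (cases "j = i"; cases "f j") (auto simp: std_join_def std_inj_def g_def)
      qed
      moreover have "P g" using insert.IH g dg by blast
      ultimately show "P f" using join[OF s g inj[OF ia]] join_F[OF s g] by simp
    qed
  qed
  moreover have "finite (dom f)" "dom f \<noteq> {}" using f unfolding carrier_F by blast+
  ultimately show ?thesis using f by blast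
qed

lemma F_lift:
  assumes T: "upper_semilattice T" and g: "\<And>i. i \<in> I \<Longrightarrow> g i \<in> semilattice_hom (A i) T"
  obtains h where "h \<in> semilattice_hom F T"
    "\<And>i a. i \<in> I \<Longrightarrow> a \<in> carrier (A i) \<Longrightarrow> h (std_inj i a) = g i a"
proof -
  interpret T: upper_semilattice T by fact
  define V where "V f = {g i a | i a. f i = Some a}" for f
  define h where "h f = \<Squnion>\<^bsub>T\<^esub>(V f)" for f
  have V: "finite (V f)" "V f \<noteq> {}" "V f \<subseteq> carrier T" if f: "f \<in> carrier F" for f
  proof -
    have "V f = (\<lambda>i. g i (the (f i))) ` dom f"
    proof (rule Set.set_eqI, rule iffI)
      fix v assume "v \<in> V f"
      then obtain i a where "f i = Some a" "v = g i a" unfolding V_def by blast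
      then show "v \<in> (\<lambda>i. g i (the (f i))) ` dom f"
        by (intro image_eqI[of _ _ i]) auto
    next
      fix v assume "v \<in> (\<lambda>i. g i (the (f i))) ` dom f"
      then obtain i a where "f i = Some a" "v = g i a" by auto
      then show "v \<in> V f" unfolding V_def by blast
    qed
    then show "finite (V f)" "V f \<noteq> {}" using f by (auto simp: carrier_F)
    show "V f \<subseteq> carrier T"
    proof
      fix v assume "v \<in> V f"
      then obtain i a where ia: "f i = Some a" and v: "v = g i a" unfolding V_def by blast
      have "i \<in> I" "a \<in> carrier (A i)" using f ia unfolding carrier_F by blast+
      then show "v \<in> carrier T" unfolding v by (rule hom_closed[OF g])
    qed
  qed
  have least: "least T (h f) (Upper T (V f))" if f: "f \<in> carrier F" for f
    unfolding h_def by (rule T.finite_sup_least[OF V(1)[OF f] V(3)[OF f] V(2)[OF f]])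
  have hc: "h f \<in> carrier T" if "f \<in> carrier F" for f
    using least[OF that] by (rule least_closed)
  have h_le: "h f \<sqsubseteq>\<^bsub>T\<^esub> t \<longleftrightarrow> (\<forall>i a. f i = Some a \<longrightarrow> g i a \<sqsubseteq>\<^bsub>T\<^esub> t)"
    if f: "f \<in> carrier F" and t: "t \<in> carrier T" for f t
  proof -
    have "h f \<sqsubseteq>\<^bsub>T\<^esub> t \<longleftrightarrow> (\<forall>v\<in>V f. v \<sqsubseteq>\<^bsub>T\<^esub> t)"
    proof
      assume *: "h f \<sqsubseteq>\<^bsub>T\<^esub> t"
      show "\<forall>v\<in>V f. v \<sqsubseteq>\<^bsub>T\<^esub> t"
      proof
        fix v assume v: "v \<in> V f"
        have "v \<in> carrier T" using v V(3)[OF f] by blast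
        moreover have "v \<sqsubseteq>\<^bsub>T\<^esub> h f" by (rule least_Upper_above[OF least[OF f] v V(3)[OF f]])
        ultimately show "v \<sqsubseteq>\<^bsub>T\<^esub> t" using usl_trans[OF T _ * _ hc[OF f] t] by simp
      qed
    next
      assume "\<forall>v\<in>V f. v \<sqsubseteq>\<^bsub>T\<^esub> t"
      then show "h f \<sqsubseteq>\<^bsub>T\<^esub> t"
        by (intro least_le[OF least[OF f]] Upper_memI t) simp
    qed
    also have "\<dots> \<longleftrightarrow> (\<forall>i a. f i = Some a \<longrightarrow> g i a \<sqsubseteq>\<^bsub>T\<^esub> t)"
      unfolding V_def by blast
    finally show ?thesis .
  qed
  have "h (std_inj i a) = g i a" if ia: "i \<in> I" "a \<in> carrier (A i)" for i a
  proof (rule usl_antisym[OF T])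
    note c = hom_closed[OF std_inj_hom, OF ia] hom_closed[OF g, OF ia]
    show "h (std_inj i a) \<in> carrier T" "g i a \<in> carrier T" using hc c by auto
    have *: "h (std_inj i a) \<sqsubseteq>\<^bsub>T\<^esub> t \<longleftrightarrow> g i a \<sqsubseteq>\<^bsub>T\<^esub> t" if "t \<in> carrier T" for t
      unfolding h_le[OF c(1) that] by (simp add: std_inj_def)
    show "h (std_inj i a) \<sqsubseteq>\<^bsub>T\<^esub> g i a" "g i a \<sqsubseteq>\<^bsub>T\<^esub> h (std_inj i a)"
      using *[OF c(2)] *[OF hc[OF c(1)]] usl_refl[OF T c(2)] usl_refl[OF T hc[OF c(1)]] by blast+
  qed
  moreover have "h (f \<squnion>\<^bsub>F\<^esub> k) = h f \<squnion>\<^bsub>T\<^esub> h k" if fk: "f \<in> carrier F" "k \<in> carrier F" for f k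
  proof (rule sym, rule usl_join_eqI[OF T])
    have jc: "std_join A f k \<in> carrier F" by (rule std_join_closed[OF fk])
    show "h f \<in> carrier T" "h k \<in> carrier T" "h (f \<squnion>\<^bsub>F\<^esub> k) \<in> carrier T"
      using fk jc hc by (auto simp: join_F)
    fix t assume t: "t \<in> carrier T"
    have "(\<forall>a. std_join A f k i = Some a \<longrightarrow> g i a \<sqsubseteq>\<^bsub>T\<^esub> t) \<longleftrightarrow>
        (\<forall>a. f i = Some a \<longrightarrow> g i a \<sqsubseteq>\<^bsub>T\<^esub> t) \<and> (\<forall>a. k i = Some a \<longrightarrow> g i a \<sqsubseteq>\<^bsub>T\<^esub> t)" for i
    proof (cases "\<exists>a b. f i = Some a \<and> k i = Some b")
      case True
      then obtain a b where ab: "f i = Some a" "k i = Some b" by blast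
      have "i \<in> I" "a \<in> carrier (A i)" "b \<in> carrier (A i)"
        using fk ab unfolding carrier_F by blast+
      then have "g i (a \<squnion>\<^bsub>A i\<^esub> b) \<sqsubseteq>\<^bsub>T\<^esub> t \<longleftrightarrow> g i a \<sqsubseteq>\<^bsub>T\<^esub> t \<and> g i b \<sqsubseteq>\<^bsub>T\<^esub> t"
        using hom_join[OF g] usl_join_le_iff[OF T _ _ t] hom_closed[OF g] by simp
      then show ?thesis using ab by (simp add: std_join_def)
    next
      case False
      then show ?thesis by (cases "f i"; cases "k i") (auto simp: std_join_def)
    qed
    then show "h (f \<squnion>\<^bsub>F\<^esub> k) \<sqsubseteq>\<^bsub>T\<^esub> t \<longleftrightarrow> h f \<sqsubseteq>\<^bsub>T\<^esub> t \<and> h k \<sqsubseteq>\<^bsub>T\<^esub> t"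
      unfolding join_F[OF fk] h_le[OF jc t] h_le[OF fk(1) t] h_le[OF fk(2) t] by blast
  qed
  moreover from this have "h \<in> semilattice_hom F T" using hc by (simp add: semilattice_hom_def)
  ultimately show ?thesis using that[of h] by simp
qed

lemma F_unique:
  assumes h: "h \<in> semilattice_hom F T" and k: "k \<in> semilattice_hom F T"
    and eq: "\<And>i a. i \<in> I \<Longrightarrow> a \<in> carrier (A i) \<Longrightarrow> h (std_inj i a) = k (std_inj i a)"
    and f: "f \<in> carrier F"
  shows "h f = k f"
  using f by (rule F_induct) (use eq hom_join[OF h] hom_join[OF k] in auto)

theorem semilattice_coproductI:
  fixes L :: "'l gorder"
  assumes L: "upper_semilattice L" and \<iota>: "\<And>i. i \<in> I \<Longrightarrow> \<iota> i \<in> semilattice_hom (A i) L"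
    and ex: "\<And>(T :: 't gorder) g. \<lbrakk>upper_semilattice T; \<And>i. i \<in> I \<Longrightarrow> g i \<in> semilattice_hom (A i) T\<rbrakk>
      \<Longrightarrow> \<exists>h\<in>semilattice_hom L T. \<forall>i\<in>I. \<forall>x\<in>carrier (A i). h (\<iota> i x) = g i x"
    and uniq: "\<And>(T :: 't gorder) h k z. \<lbrakk>upper_semilattice T;
      h \<in> semilattice_hom L T; k \<in> semilattice_hom L T;
      \<And>i x. i \<in> I \<Longrightarrow> x \<in> carrier (A i) \<Longrightarrow> h (\<iota> i x) = k (\<iota> i x); z \<in> carrier L\<rbrakk> \<Longrightarrow> h z = k z"
  shows "semilattice_coproduct TYPE('t) I A L \<iota>"
  unfolding semilattice_coproduct_def
proof (intro conjI ballI allI impI)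
  fix T :: "'t gorder" and g
  assume Tg: "upper_semilattice T \<and> (\<forall>i\<in>I. g i \<in> semilattice_hom (A i) T)"
  then obtain h where h: "h \<in> semilattice_hom L T" "\<forall>i\<in>I. \<forall>x\<in>carrier (A i). h (\<iota> i x) = g i x"
    using ex[of T g] by blast
  show "\<exists>!h. h \<in> semilattice_hom L T \<and> h \<in> extensional (carrier L) \<and>
      (\<forall>i\<in>I. \<forall>x\<in>carrier (A i). h (\<iota> i x) = g i x)"
  proof (rule ex1I)
    show "restrict h (carrier L) \<in> semilattice_hom L T \<and>
        restrict h (carrier L) \<in> extensional (carrier L) \<and>
        (\<forall>i\<in>I. \<forall>x\<in>carrier (A i). restrict h (carrier L) (\<iota> i x) = g i x)"
      using hom_restrict[OF L h(1)] h(2) hom_closed[OF \<iota>] by auto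
    fix k assume k: "k \<in> semilattice_hom L T \<and> k \<in> extensional (carrier L) \<and>
        (\<forall>i\<in>I. \<forall>x\<in>carrier (A i). k (\<iota> i x) = g i x)"
    have "k z = h z" if "z \<in> carrier L" for z
      by (rule uniq[of T]) (use Tg h k that in auto)
    then show "k = restrict h (carrier L)"
      using k by (auto intro: extensionalityI[of _ "carrier L"])
  qed
qed (use L \<iota> in auto)

theorem std_free_product_universal: "semilattice_coproduct TYPE('t) I A F std_inj"
proof (rule semilattice_coproductI)
  fix T :: "'t gorder" and g
  assume T: "upper_semilattice T" and g: "\<And>i. i \<in> I \<Longrightarrow> g i \<in> semilattice_hom (A i) T"
  obtain h where "h \<in> semilattice_hom F T"
    "\<And>i a. i \<in> I \<Longrightarrow> a \<in> carrier (A i) \<Longrightarrow> h (std_inj i a) = g i a"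
    by (rule F_lift[OF T, where g = g]) (use g in auto)
  then show "\<exists>h\<in>semilattice_hom F T. \<forall>i\<in>I. \<forall>x\<in>carrier (A i). h (std_inj i x) = g i x"
    by blast
next
  fix T :: "'t gorder" and h k z
  assume "h \<in> semilattice_hom F T" "k \<in> semilattice_hom F T"
    "\<And>i x. i \<in> I \<Longrightarrow> x \<in> carrier (A i) \<Longrightarrow> h (std_inj i x) = k (std_inj i x)" "z \<in> carrier F"
  then show "h z = k z" by (rule F_unique)
qed (fact usl_F, erule std_inj_hom)

corollary free_product_exists: "free_product I A F std_inj"
  unfolding free_product_def by (rule std_free_product_universal)

theorem free_product_universal:
  fixes L :: "'l gorder"
  assumes fp: "free_product I A L \<iota>"
  shows "semilattice_coproduct TYPE('t) I A L \<iota>"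
proof -
  note cop = fp[unfolded free_product_def]
  have L: "upper_semilattice L" and \<iota>: "\<And>i. i \<in> I \<Longrightarrow> \<iota> i \<in> semilattice_hom (A i) L"
    using cop unfolding semilattice_coproduct_def by blast+
  obtain h where h: "h \<in> semilattice_hom L F"
    "\<And>i x. i \<in> I \<Longrightarrow> x \<in> carrier (A i) \<Longrightarrow> h (\<iota> i x) = std_inj i x"
    by (rule coproduct_ex[OF cop usl_F, where g = std_inj]) (use std_inj_hom in auto)
  obtain k where k: "k \<in> semilattice_hom F L"
    "\<And>i x. i \<in> I \<Longrightarrow> x \<in> carrier (A i) \<Longrightarrow> k (std_inj i x) = \<iota> i x"
    by (rule F_lift[OF L, where g = \<iota>]) (use \<iota> in auto)
  have surj: "z \<in> k ` carrier F" if z: "z \<in> carrier L" for z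
  proof -
    define p q where "p = (\<lambda>_::'i. None :: 'a option)" and "q = (\<lambda>_::'i. Some undefined :: 'a option)"
    have pq: "p \<noteq> q" by (auto simp: p_def q_def fun_eq_iff)
    define C :: "('i \<Rightarrow> 'a option) gorder" where "C = \<lparr>carrier = {p, q}, eq = (=), le = (\<lambda>x y. x = p \<or> y = q)\<rparr>"
    have C [simp]: "carrier C = {p, q}" "\<And>x y. x \<sqsubseteq>\<^bsub>C\<^esub> y \<longleftrightarrow> x = p \<or> y = q"
      by (auto simp: C_def)
    have usl_C: "upper_semilattice C"
    proof (rule uslI)
      fix x y assume "x \<in> carrier C" "y \<in> carrier C"
      then show "\<exists>u\<in>carrier C. \<forall>z\<in>carrier C. u \<sqsubseteq>\<^bsub>C\<^esub> z \<longleftrightarrow> x \<sqsubseteq>\<^bsub>C\<^esub> z \<and> y \<sqsubseteq>\<^bsub>C\<^esub> z"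
        using pq by auto
    qed (use pq in \<open>auto simp: C_def\<close>)
    have hom_C: "(\<lambda>x. if D x then p else q) \<in> semilattice_hom L C"
      if D: "\<And>x y. x \<in> carrier L \<Longrightarrow> y \<in> carrier L \<Longrightarrow> D (x \<squnion>\<^bsub>L\<^esub> y) \<longleftrightarrow> D x \<and> D y" for D
      unfolding semilattice_hom_def
    proof (intro CollectI conjI ballI)
      fix x y assume xy: "x \<in> carrier L" "y \<in> carrier L"
      show "(if D (x \<squnion>\<^bsub>L\<^esub> y) then p else q) =
          (if D x then p else q) \<squnion>\<^bsub>C\<^esub> (if D y then p else q)"
        unfolding D[OF xy] by (rule usl_join_eqI[OF usl_C, symmetric]) (use pq in auto)
    qed auto
    let ?u = "\<lambda>x. if x \<sqsubseteq>\<^bsub>L\<^esub> z then p else q"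
    let ?D = "\<lambda>x. \<exists>s\<in>k ` carrier F. x \<sqsubseteq>\<^bsub>L\<^esub> s \<and> s \<sqsubseteq>\<^bsub>L\<^esub> z"
    let ?v = "\<lambda>x. if ?D x then p else q"
    have S: "s \<in> carrier L" if "s \<in> k ` carrier F" for s
      using that hom_closed[OF k(1)] by blast
    have S_join: "s \<squnion>\<^bsub>L\<^esub> s' \<in> k ` carrier F" if "s \<in> k ` carrier F" "s' \<in> k ` carrier F" for s s'
      using that hom_join[OF k(1), symmetric] usl_join_closed[OF usl_F] by auto
    have "?u \<in> semilattice_hom L C"
      by (rule hom_C) (use usl_join_le_iff[OF L _ _ z] in blast)
    moreover have "?v \<in> semilattice_hom L C"
    proof (rule hom_C)
      fix x y assume xy: "x \<in> carrier L" "y \<in> carrier L"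
      show "?D (x \<squnion>\<^bsub>L\<^esub> y) \<longleftrightarrow> ?D x \<and> ?D y"
      proof
        assume "?D (x \<squnion>\<^bsub>L\<^esub> y)"
        then show "?D x \<and> ?D y" using usl_join_le_iff[OF L xy S] by blast
      next
        assume "?D x \<and> ?D y"
        then obtain s s' where s: "s \<in> k ` carrier F" "x \<sqsubseteq>\<^bsub>L\<^esub> s" "s \<sqsubseteq>\<^bsub>L\<^esub> z"
          and s': "s' \<in> k ` carrier F" "y \<sqsubseteq>\<^bsub>L\<^esub> s'" "s' \<sqsubseteq>\<^bsub>L\<^esub> z" by blast
        note ss = S[OF s(1)] S[OF s'(1)]
        note j = usl_join_closed[OF L ss]
        have "s \<sqsubseteq>\<^bsub>L\<^esub> s \<squnion>\<^bsub>L\<^esub> s'" "s' \<sqsubseteq>\<^bsub>L\<^esub> s \<squnion>\<^bsub>L\<^esub> s'"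
          using usl_join_le_iff[OF L ss j] usl_refl[OF L j] by auto
        then have "x \<sqsubseteq>\<^bsub>L\<^esub> s \<squnion>\<^bsub>L\<^esub> s'" "y \<sqsubseteq>\<^bsub>L\<^esub> s \<squnion>\<^bsub>L\<^esub> s'"
          using usl_trans[OF L] s(2) s'(2) xy ss j by blast+
        then have "x \<squnion>\<^bsub>L\<^esub> y \<sqsubseteq>\<^bsub>L\<^esub> s \<squnion>\<^bsub>L\<^esub> s'" using usl_join_le_iff[OF L xy j] by blast
        moreover have "s \<squnion>\<^bsub>L\<^esub> s' \<sqsubseteq>\<^bsub>L\<^esub> z" using usl_join_le_iff[OF L ss z] s(3) s'(3) by blast
        ultimately show "?D (x \<squnion>\<^bsub>L\<^esub> y)" using S_join[OF s(1) s'(1)] by blast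
      qed
    qed
    moreover have "?u (\<iota> i x) = ?v (\<iota> i x)" if ix: "i \<in> I" "x \<in> carrier (A i)" for i x
    proof -
      have \<iota>S: "\<iota> i x \<in> k ` carrier F"
        using k(2)[OF ix] hom_closed[OF std_inj_hom, OF ix] by (metis imageI)
      have "?D (\<iota> i x) \<longleftrightarrow> \<iota> i x \<sqsubseteq>\<^bsub>L\<^esub> z"
      proof
        assume "?D (\<iota> i x)"
        then obtain s where s: "s \<in> k ` carrier F" "\<iota> i x \<sqsubseteq>\<^bsub>L\<^esub> s" "s \<sqsubseteq>\<^bsub>L\<^esub> z" by blast
        show "\<iota> i x \<sqsubseteq>\<^bsub>L\<^esub> z" by (rule usl_trans[OF L s(2,3) S[OF \<iota>S] S[OF s(1)] z])
      next
        assume "\<iota> i x \<sqsubseteq>\<^bsub>L\<^esub> z"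
        then show "?D (\<iota> i x)" using usl_refl[OF L S[OF \<iota>S]] \<iota>S by blast
      qed
      then show ?thesis by simp
    qed
    ultimately have "?u z = ?v z"
      by (rule coproduct_unique[OF cop usl_C _ _ _ z])
    then have "?D z" using usl_refl[OF L z] pq by (auto split: if_splits)
    then obtain s where s: "s \<in> k ` carrier F" "z \<sqsubseteq>\<^bsub>L\<^esub> s" "s \<sqsubseteq>\<^bsub>L\<^esub> z" by blast
    have "z = s" by (rule usl_antisym[OF L s(2,3) z S[OF s(1)]])
    then show ?thesis using s(1) by simp
  qed
  show ?thesis
  proof (rule semilattice_coproductI[OF L \<iota>])
    fix T :: "'t gorder" and g
    assume T: "upper_semilattice T" and g: "\<And>i. i \<in> I \<Longrightarrow> g i \<in> semilattice_hom (A i) T"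
    obtain m where m: "m \<in> semilattice_hom F T"
      "\<And>i x. i \<in> I \<Longrightarrow> x \<in> carrier (A i) \<Longrightarrow> m (std_inj i x) = g i x"
      by (rule F_lift[OF T, where g = g]) (use g in auto)
    show "\<exists>h\<in>semilattice_hom L T. \<forall>i\<in>I. \<forall>x\<in>carrier (A i). h (\<iota> i x) = g i x"
      by (rule bexI[OF _ hom_comp[OF h(1) m(1)]]) (use h(2) m(2) in auto)
  next
    fix T :: "'t gorder" and u v z
    assume T: "upper_semilattice T" and u: "u \<in> semilattice_hom L T" and v: "v \<in> semilattice_hom L T"
      and eq: "\<And>i x. i \<in> I \<Longrightarrow> x \<in> carrier (A i) \<Longrightarrow> u (\<iota> i x) = v (\<iota> i x)" and z: "z \<in> carrier L"
    obtain f where f: "f \<in> carrier F" "z = k f" using surj[OF z] by blast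
    have "u (k f) = v (k f)"
      by (rule F_unique[OF hom_comp[OF k(1) u] hom_comp[OF k(1) v] _ f(1)]) (use eq k(2) in auto)
    then show "u z = v z" using f by simp
  qed
qed

theorem free_product_embedding:
  assumes fp: "free_product I A L \<iota>" and i: "i \<in> I"
    and xy: "x \<in> carrier (A i)" "y \<in> carrier (A i)"
  shows "\<iota> i x \<sqsubseteq>\<^bsub>L\<^esub> \<iota> i y \<longleftrightarrow> x \<sqsubseteq>\<^bsub>A i\<^esub> y"
proof -
  note cop = fp[unfolded free_product_def]
  have L: "upper_semilattice L" and \<iota>: "\<And>i. i \<in> I \<Longrightarrow> \<iota> i \<in> semilattice_hom (A i) L"
    using cop unfolding semilattice_coproduct_def by blast+
  obtain h where h: "h \<in> semilattice_hom L F"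
    "\<And>i x. i \<in> I \<Longrightarrow> x \<in> carrier (A i) \<Longrightarrow> h (\<iota> i x) = std_inj i x"
    by (rule coproduct_ex[OF cop usl_F, where g = std_inj]) (use std_inj_hom in auto)
  note c = hom_closed[OF \<iota>, OF i xy(1)] hom_closed[OF \<iota>, OF i xy(2)]
  have "x \<sqsubseteq>\<^bsub>A i\<^esub> y" if "\<iota> i x \<sqsubseteq>\<^bsub>L\<^esub> \<iota> i y"
  proof -
    have "std_inj i x \<sqsubseteq>\<^bsub>F\<^esub> std_inj i y"
      using hom_mono[OF L usl_F h(1) c that] unfolding h(2)[OF i xy(1)] h(2)[OF i xy(2)] .
    from this[unfolded le_F, rule_format, of i x] show ?thesis by (simp add: std_inj_def)
  qed
  then show ?thesis using hom_mono[OF usl[OF i] L \<iota>[OF i] xy] by blast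
qed

end

end

theory Submission
  imports Defs
begin

text \<open>
  Only \<open>std_free_product I A\<close> needs a map, since \<open>L\<close> maps homomorphically to it.  Below an element
  of the standard free product, represented by the partial function \<open>f\<close>, lie exactly the partial
  functions with smaller domain and smaller values.  So sending \<open>f\<close> to the join of the finitely
  many \<open>\<phi> i (f i)\<close> is isotone as soon as every \<open>\<phi> i\<close> is.
\<close>

lemma isotone_semilatticeI:
  assumes "upper_semilattice S" "upper_semilattice T"
    and "\<And>x y. \<lbrakk>x \<in> carrier S; y \<in> carrier S; x \<sqsubseteq>\<^bsub>S\<^esub> y\<rbrakk> \<Longrightarrow> f x \<sqsubseteq>\<^bsub>T\<^esub> f y"
  shows "isotone S T f"
proof -
  interpret S: upper_semilattice S by fact
  interpret T: upper_semilattice T by fact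
  show ?thesis
    by (rule isotoneI[OF S.weak_partial_order_axioms T.weak_partial_order_axioms assms(3)])
qed

text \<open>The isotone counterpart of \<open>F_lift\<close>, with the same candidate map. Join
  preservation is lost, since \<open>g i\<close> may send a join strictly above the join of the
  images.\<close>

lemma (in semilattice_family) F_isotone_lift:
  assumes T: "upper_semilattice T"
    and closed: "\<And>i. i \<in> I \<Longrightarrow> g i \<in> carrier (A i) \<rightarrow> carrier T"
    and iso: "\<And>i. i \<in> I \<Longrightarrow> isotone (A i) T (g i)"
  obtains h where "h \<in> carrier F \<rightarrow> carrier T" "isotone F T h"
    "\<And>i a. i \<in> I \<Longrightarrow> a \<in> carrier (A i) \<Longrightarrow> h (std_inj i a) = g i a"
proof -
  interpret T: upper_semilattice T by fact
  \<comment> \<open>Since \<open>dom f\<close> is finite and nonempty, so is \<open>V f\<close>;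
    hence its join exists in \<open>T\<close> even without a least element.\<close>
  define V where "V f = (\<lambda>i. g i (the (f i))) ` dom f" for f
  define h where "h f = \<Squnion>\<^bsub>T\<^esub>(V f)" for f
  have V: "finite (V f)" "V f \<noteq> {}" "V f \<subseteq> carrier T" if "f \<in> carrier F" for f
    using that closed by (fastforce simp: V_def carrier_F)+
  have least: "least T (h f) (Upper T (V f))" if "f \<in> carrier F" for f
    unfolding h_def using V[OF that] by (intro T.finite_sup_least)
  have hc: "h f \<in> carrier T" if "f \<in> carrier F" for f
    using least[OF that] by (rule least_closed)
  have upper: "g i a \<sqsubseteq>\<^bsub>T\<^esub> h f" if f: "f \<in> carrier F" and a: "f i = Some a" for f i a
  proof -
    have "g i a \<in> V f" unfolding V_def by (rule image_eqI[of _ _ i]) (use a in auto)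
    then show ?thesis by (rule least_Upper_above[OF least[OF f] _ V(3)[OF f]])
  qed
  \<comment> \<open>As \<open>h f\<close> is the least upper bound of \<open>V f\<close>, it
    suffices that \<open>h k\<close> bounds \<open>V f\<close>. For \<open>f i = Some a\<close> and
    \<open>k i = Some b\<close> the chain is \<open>g i a\<close> \<le> \<open>g i b\<close> \<le>
    \<open>h k\<close>.\<close>
  have mono: "h f \<sqsubseteq>\<^bsub>T\<^esub> h k" if fk: "f \<in> carrier F" "k \<in> carrier F" "f \<sqsubseteq>\<^bsub>F\<^esub> k" for f k
  proof (rule least_le[OF least[OF fk(1)] Upper_memI[OF _ hc[OF fk(2)]]])
    fix v assume "v \<in> V f"
    then obtain i a where a: "f i = Some a" and v: "v = g i a" unfolding V_def by auto
    obtain b where b: "k i = Some b" "a \<sqsubseteq>\<^bsub>A i\<^esub> b" using fk(3) a unfolding le_F by blast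
    have i: "i \<in> I" and ab: "a \<in> carrier (A i)" "b \<in> carrier (A i)"
      using fk(1,2) a b(1) unfolding carrier_F by blast+
    have "g i a \<sqsubseteq>\<^bsub>T\<^esub> g i b" using iso[OF i] ab b(2) by (rule use_iso2)
    moreover have "g i a \<in> carrier T" "g i b \<in> carrier T" using closed[OF i] ab by auto
    ultimately show "v \<sqsubseteq>\<^bsub>T\<^esub> h k"
      unfolding v using usl_trans[OF T _ upper[OF fk(2) b(1)]] hc[OF fk(2)] by blast
  qed
  have "h (std_inj i a) = g i a" if "i \<in> I" "a \<in> carrier (A i)" for i a
  proof -
    \<comment> \<open>The domain of \<open>std_inj i a\<close> is a singleton, so the join is taken
      over one element.\<close>
    have "V (std_inj i a) = {g i a}" by (simp add: V_def std_inj_def)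
    moreover have "g i a \<in> carrier T" using closed that by blast
    ultimately show ?thesis
      unfolding h_def using T.weak_sup_of_singleton[of "g i a"] T.eq_is_equal by simp
  qed
  moreover have "isotone F T h" by (rule isotone_semilatticeI[OF usl_F T]) (rule mono)
  ultimately show ?thesis using that[of h] hc by blast
qed

theorem theorem11:
  fixes I :: "'i set"
    and A :: "'i \<Rightarrow> 'a gorder"
    and M :: "'m gorder"
    and \<phi> :: "'i \<Rightarrow> 'a \<Rightarrow> 'm"
    and L :: "'l gorder"
    and \<iota> :: "'i \<Rightarrow> 'a \<Rightarrow> 'l"
  assumes "\<And>i. i \<in> I \<Longrightarrow> upper_semilattice (A i)"
    and "upper_semilattice M"
    and "\<And>i. i \<in> I \<Longrightarrow> \<phi> i \<in> carrier (A i) \<rightarrow> carrier M"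
    and "\<And>i. i \<in> I \<Longrightarrow> isotone (A i) M (\<phi> i)"
    and "free_product I A L \<iota>"
  shows "\<exists>\<psi> \<in> carrier L \<rightarrow> carrier M. isotone L M \<psi> \<and>
           (\<forall>i\<in>I. \<forall>x\<in>carrier (A i). \<psi> (\<iota> i x) = \<phi> i x)"
proof -
  interpret semilattice_family I A by (rule semilattice_family.intro) (rule assms(1))
  note cop = assms(5)[unfolded free_product_def]
  have L: "upper_semilattice L" using cop unfolding semilattice_coproduct_def by blast
  \<comment> \<open>The elements of \<open>F\<close> have exactly the type over which
    \<open>free_product\<close> tests, so its universal property applies to \<open>F\<close>
    directly.\<close>
  obtain h where h: "h \<in> semilattice_hom L F"
    "\<And>i x. i \<in> I \<Longrightarrow> x \<in> carrier (A i) \<Longrightarrow> h (\<iota> i x) = std_inj i x"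
    by (rule coproduct_ex[OF cop usl_F, where g = std_inj]) (use std_inj_hom in auto)
  obtain m where m: "m \<in> carrier F \<rightarrow> carrier M" "isotone F M m"
    "\<And>i x. i \<in> I \<Longrightarrow> x \<in> carrier (A i) \<Longrightarrow> m (std_inj i x) = \<phi> i x"
    by (rule F_isotone_lift[OF assms(2), of \<phi>]) (use assms(3,4) that in auto)
  \<comment> \<open>The witness is \<open>m\<close> after \<open>h\<close>: \<open>h\<close> is
    isotone because it preserves joins, and \<open>m\<close> is isotone by construction.\<close>
  have "isotone L M (\<lambda>z. m (h z))"
  proof (rule isotone_semilatticeI[OF L assms(2)])
    fix x y assume xy: "x \<in> carrier L" "y \<in> carrier L" "x \<sqsubseteq>\<^bsub>L\<^esub> y"
    show "m (h x) \<sqsubseteq>\<^bsub>M\<^esub> m (h y)"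
      by (rule use_iso2[OF m(2) hom_closed[OF h(1) xy(1)] hom_closed[OF h(1) xy(2)]
            hom_mono[OF L usl_F h(1) xy]])
  qed
  moreover have "(\<lambda>z. m (h z)) \<in> carrier L \<rightarrow> carrier M"
    using m(1) hom_closed[OF h(1)] by blast
  moreover have "\<forall>i\<in>I. \<forall>x\<in>carrier (A i). m (h (\<iota> i x)) = \<phi> i x"
    by (simp add: h(2) m(3))
  ultimately show ?thesis by blast
qed

end
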